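(* Let $n\leq m$ be positive integers. Then $B(P_n \square P_m) = 2$ if $n = m = 2$; $B(P_n \square P_m) = 3$ if $n = 2$ and $m \geq 3$; $B(P_n \square P_m) = 4$ if $n=3$ and $m \geq 3$; and $B(P_n \square P_m) = 5$ if $n, m\geq 4$.
   Context: $P_n$ is the path on $n$ vertices. The Cartesian product $G\square H$ has vertex set $V(G)\times V(H)$, with $(u,v)$ adjacent to $(x,y)$ iff either $ux\in E(G)$ and $v=y$, or $u=x$ and $vy\in E(H)$. Bodyguards and Presidents is a two-player game on a finite simple graph $G$. One player controls a set of tokens called bodyguards, the other a single token called the president. First all bodyguards are placed on vertices (several may share a vertex), then the president is placed. The players then alternate turns, bodyguards first; on a player's turn, each token they control either moves to an adjacent vertex or stays put. The president is surrounded if every vertex of the open neighbourhood of the president's vertex is occupied by a bodyguard. The bodyguards win if there is a finite time after which, at the end of every bodyguard turn, the president is surrounded; otherwise the president wins. The bodyguard number $B(G)$ is the minimum number of bodyguards that guarantees a win for the bodyguards on $G$. *)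

theory Defs
  imports "Graph_Theory.Pair_Digraph"
begin

text \<open>
  A finite simple graph is a \<^locale>\<open>pair_graph\<close>: a finite, loop-free digraph on pairs
  whose arc relation is symmetric.
\<close>

definition path_graph :: "nat \<Rightarrow> nat pair_pre_digraph" where
  "path_graph n =
     \<lparr>pverts = {0..<n},
      parcs = {(i, j). i < n \<and> j < n \<and> (j = Suc i \<or> i = Suc j)}\<rparr>"

definition cartesian_product ::
    "'a pair_pre_digraph \<Rightarrow> 'b pair_pre_digraph \<Rightarrow> ('a \<times> 'b) pair_pre_digraph"
    (infixr "\<box>" 80) where
  "G \<box> H =
     \<lparr>pverts = pverts G \<times> pverts H,
      parcs = {((u, v), (x, y)).
        (u, v) \<in> pverts G \<times> pverts H \<and> (x, y) \<in> pverts G \<times> pverts H \<and>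
        ((u, x) \<in> parcs G \<and> v = y \<or> u = x \<and> (v, y) \<in> parcs H)}\<rparr>"

lemma pair_graph_path_graph: "pair_graph (path_graph n)"
proof -
  have "parcs (path_graph n) \<subseteq> {0..<n} \<times> {0..<n}"
    by (auto simp: path_graph_def)
  then have "finite (parcs (path_graph n))"
    by (rule finite_subset) simp
  then show ?thesis
    by unfold_locales (auto simp: path_graph_def symmetric_def sym_def)
qed

lemma pair_graph_cartesian_product:
  assumes "pair_graph G" and "pair_graph H"
  shows "pair_graph (G \<box> H)"
proof -
  interpret G: pair_graph G by fact
  interpret H: pair_graph H by fact
  have fin: "finite (pverts (G \<box> H))"
    by (simp add: cartesian_product_def G.pair_finite_verts H.pair_finite_verts)
  have "parcs (G \<box> H) \<subseteq> pverts (G \<box> H) \<times> pverts (G \<box> H)"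
    by (auto simp: cartesian_product_def)
  then have "finite (parcs (G \<box> H))"
    by (rule finite_subset) (simp add: fin)
  moreover have "sym (parcs G)" "sym (parcs H)"
    using G.pair_sym_arcs H.pair_sym_arcs by (auto simp: symmetric_def)
  ultimately show ?thesis
    using fin G.pair_no_loops H.pair_no_loops
    by unfold_locales
      (fastforce simp: cartesian_product_def symmetric_def dest: symD intro!: symI)+
qed

definition open_nbhd :: "'a pair_pre_digraph \<Rightarrow> 'a \<Rightarrow> 'a set" where
  "open_nbhd G v = {w \<in> pverts G. (v, w) \<in> parcs G}"

definition token_step :: "'a pair_pre_digraph \<Rightarrow> 'a \<Rightarrow> 'a \<Rightarrow> bool" where
  "token_step G u v \<longleftrightarrow> v = u \<or> v \<in> open_nbhd G u"

text \<open>
  The bodyguards are distinguishable tokens: a placement of \<open>k\<close> of them is a list of length \<open>k\<close>,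
  whose \<open>i\<close>-th entry is the vertex of bodyguard \<open>i\<close>.
\<close>

definition placement :: "'a pair_pre_digraph \<Rightarrow> nat \<Rightarrow> 'a list \<Rightarrow> bool" where
  "placement G k bs \<longleftrightarrow> length bs = k \<and> set bs \<subseteq> pverts G"

definition surrounded :: "'a pair_pre_digraph \<Rightarrow> 'a list \<Rightarrow> 'a \<Rightarrow> bool" where
  "surrounded G bs v \<longleftrightarrow> open_nbhd G v \<subseteq> set bs"

text \<open>
  A play is a pair of sequences: \<open>b 0\<close>, \<open>p 0\<close> are the initial placements, and in round \<open>t\<close> the
  bodyguards first move from \<open>b t\<close> to \<open>b (Suc t)\<close>, after which the president moves from \<open>p t\<close> to
  \<open>p (Suc t)\<close>. So at the end of the bodyguards' turn in round \<open>t\<close> the position is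
  \<open>(b (Suc t), p t)\<close>.

  A bodyguard strategy consists of an initial placement and a function that maps the history of
  all positions so far, oldest first, to the next placement of the bodyguards.
\<close>

type_synonym 'a strategy = "('a list \<times> 'a) list \<Rightarrow> 'a list"

definition president_legal :: "'a pair_pre_digraph \<Rightarrow> (nat \<Rightarrow> 'a) \<Rightarrow> bool" where
  "president_legal G p \<longleftrightarrow> p 0 \<in> pverts G \<and> (\<forall>t. token_step G (p t) (p (Suc t)))"

definition bodyguards_legal :: "'a pair_pre_digraph \<Rightarrow> nat \<Rightarrow> (nat \<Rightarrow> 'a list) \<Rightarrow> bool" where
  "bodyguards_legal G k b \<longleftrightarrow>
     placement G k (b 0) \<and> (\<forall>t. list_all2 (token_step G) (b t) (b (Suc t)))"

definition follows ::
    "'a list \<Rightarrow> 'a strategy \<Rightarrow> (nat \<Rightarrow> 'a list) \<Rightarrow> (nat \<Rightarrow> 'a) \<Rightarrow> bool" where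
  "follows b0 \<sigma> b p \<longleftrightarrow>
     b 0 = b0 \<and> (\<forall>t. b (Suc t) = \<sigma> (map (\<lambda>s. (b s, p s)) [0..<Suc t]))"

definition bodyguards_win_play ::
    "'a pair_pre_digraph \<Rightarrow> (nat \<Rightarrow> 'a list) \<Rightarrow> (nat \<Rightarrow> 'a) \<Rightarrow> bool" where
  "bodyguards_win_play G b p \<longleftrightarrow> (\<exists>T. \<forall>t\<ge>T. surrounded G (b (Suc t)) (p t))"

definition winning_strategy ::
    "'a pair_pre_digraph \<Rightarrow> nat \<Rightarrow> 'a list \<Rightarrow> 'a strategy \<Rightarrow> bool" where
  "winning_strategy G k b0 \<sigma> \<longleftrightarrow>
     placement G k b0 \<and>
     (\<forall>b p. president_legal G p \<longrightarrow> follows b0 \<sigma> b p \<longrightarrow>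
        bodyguards_legal G k b \<and> bodyguards_win_play G b p)"

definition bodyguards_can_win :: "'a pair_pre_digraph \<Rightarrow> nat \<Rightarrow> bool" where
  "bodyguards_can_win G k \<longleftrightarrow> (\<exists>b0 \<sigma>. winning_strategy G k b0 \<sigma>)"

definition bodyguard_number :: "'a pair_pre_digraph \<Rightarrow> nat" where
  "bodyguard_number G = (LEAST k. bodyguards_can_win G k)"

text \<open>
  On a finite graph the minimum is over a nonempty set: one bodyguard per vertex suffices.
\<close>

lemma president_stays_in_pverts:
  assumes "president_legal G p"
  shows "p t \<in> pverts G"
  using assms
  by (induction t) (auto simp: president_legal_def token_step_def open_nbhd_def, metis)

lemma bodyguards_can_win_card:
  assumes "finite (pverts G)"
  shows "bodyguards_can_win G (card (pverts G))"
proof -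
  obtain b0 where b0: "set b0 = pverts G" "distinct b0"
    using finite_distinct_list[OF assms] by blast
  have const: "b t = b0" if "follows b0 (\<lambda>_. b0) b p" for b t and p :: "nat \<Rightarrow> 'a"
    using that by (cases t) (auto simp: follows_def)
  have "winning_strategy G (card (pverts G)) b0 (\<lambda>_. b0)"
    unfolding winning_strategy_def
  proof (intro conjI allI impI)
    show "placement G (card (pverts G)) b0"
      using b0 by (auto simp: placement_def distinct_card[symmetric])
    fix b and p :: "nat \<Rightarrow> 'a"
    assume "follows b0 (\<lambda>_. b0) b p"
    then have b: "b t = b0" for t
      by (rule const)
    show "bodyguards_legal G (card (pverts G)) b"
      using b0 by (auto simp: bodyguards_legal_def b placement_def distinct_card[symmetric]
          token_step_def list_all2_same)
    show "bodyguards_win_play G b p"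
      using b0 by (auto simp: bodyguards_win_play_def b surrounded_def open_nbhd_def)
  qed
  then show ?thesis
    unfolding bodyguards_can_win_def by blast
qed

lemma bodyguard_number_can_win:
  assumes "pair_graph G"
  shows "bodyguards_can_win G (bodyguard_number G)"
proof -
  interpret pair_graph G by fact
  show ?thesis
    unfolding bodyguard_number_def
    using bodyguards_can_win_card[OF pair_finite_verts] by (rule LeastI)
qed

end

theory Submission
  imports Defs "HOL-Library.Multiset"
begin

text \<open>
  Upper bounds. A target is a vertex that depends on the president's position through a
  non-expansive map in each coordinate, such as the (clamped) neighbour to the left; once a guard
  stands on its target it can stay there forever. Two guards, one aiming first for the row and the other
  first for the column, can always make one of them reach its target. Hence \<open>k + 1\<close> guards occupy \<open>k\<close>
  targets, so five guards surround the president on every grid. On grids with two or three rows the last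
  target is reached by a single guard, which exploits the small number of rows and at the end exchanges
  roles with the other guards.

  Lower bounds. A president standing still on a vertex of maximum degree needs that many guards. If
  \<open>n, m \<ge> 4\<close>, then four guards cannot catch a president who stays in a square of four interior vertices:
  if they could surround the president after each possible move within the square, then, counting
  displacements and parities, they would already have surrounded it.
\<close>

section \<open>Forcing positions and extracting strategies\<close>

text \<open>
  A position \<open>(M, p)\<close> is taken at the end of the bodyguards' turn, so the president moves first. The
  guards are kept as a multiset, so that they can exchange roles freely.
\<close>

inductive force :: "('a \<Rightarrow> 'a \<Rightarrow> bool) \<Rightarrow> ('a multiset \<Rightarrow> 'a \<Rightarrow> bool) \<Rightarrow> 'a multiset \<Rightarrow> 'a \<Rightarrow> bool"
  for R Q where
  force_now: "Q M p \<Longrightarrow> force R Q M p"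
| force_step: "\<forall>q. R p q \<longrightarrow> (\<exists>M'. rel_mset R M M' \<and> force R Q M' q) \<Longrightarrow> force R Q M p"

lemma force_trans:
  assumes "force R P M p" and "\<And>M p. P M p \<Longrightarrow> force R Q M p"
  shows "force R Q M p"
  using assms(1)
proof induction
  case (force_now M p)
  then show ?case by (rule assms(2))
next
  case (force_step p M)
  then show ?case by (intro force.force_step) blast
qed

text \<open>The round-bounded form of \<open>force\<close>; its least bound serves as a rank by
  which moves are chosen. The first disjunct makes it monotone in the bound.\<close>

primrec force_in :: "('a \<Rightarrow> 'a \<Rightarrow> bool) \<Rightarrow> ('a multiset \<Rightarrow> 'a \<Rightarrow> bool) \<Rightarrow> nat \<Rightarrow> 'a multiset \<Rightarrow> 'a \<Rightarrow> bool"
  where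
  "force_in R Q 0 M p = Q M p"
| "force_in R Q (Suc k) M p =
     (force_in R Q k M p \<or> (\<forall>q. R p q \<longrightarrow> (\<exists>M'. rel_mset R M M' \<and> force_in R Q k M' q)))"

lemma force_in_mono: "force_in R Q k M p \<Longrightarrow> k \<le> l \<Longrightarrow> force_in R Q l M p"
  by (induction l) (auto simp: le_Suc_eq)

text \<open>The bounds for the president's finitely many answers have a maximum, which by
  monotonicity serves all of them.\<close>

lemma force_imp_force_in:
  assumes "force R Q M p" and fin: "\<And>p. finite {q. R p q}"
  shows "\<exists>k. force_in R Q k M p"
  using assms(1)
proof induction
  case (force_now M p)
  then have "force_in R Q 0 M p" by simp
  then show ?case ..
next
  case (force_step p M)
  then have "\<forall>q. \<exists>k. R p q \<longrightarrow> (\<exists>M'. rel_mset R M M' \<and> force_in R Q k M' q)" by blast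
  then obtain k where k: "\<And>q. R p q \<Longrightarrow> \<exists>M'. rel_mset R M M' \<and> force_in R Q (k q) M' q"
    by metis
  define l where "l = Max (k ` {q. R p q})"
  have "\<exists>M'. rel_mset R M M' \<and> force_in R Q l M' q" if "R p q" for q
    using k[OF that] force_in_mono[of R Q "k q" _ q l] that fin
    by (auto simp: l_def)
  then have "force_in R Q (Suc l) M p" by simp
  then show ?case ..
qed

text \<open>Translates a move of anonymous guards back into one of distinguishable tokens: the new
  multiset is listed in the order of \<open>xs\<close>.\<close>

lemma rel_mset_list_move:
  assumes "rel_mset R (mset xs) M"
  obtains ys where "list_all2 R xs ys" "mset ys = M"
  using assms list_all2_reorder_left_invariance unfolding rel_mset_def by metis

text \<open>The strategy is positional: among the available placements from which \<open>C\<close>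
  can be forced, take one of least rank \<open>rk\<close>. The rank drops every round until it is 0;
  there \<open>C\<close> holds, and \<open>keep\<close> preserves it.\<close>

lemma bodyguards_can_winI:
  assumes fin: "finite (pverts G)"
    and R_step: "\<And>u v. R u v \<longleftrightarrow> u \<in> pverts G \<and> token_step G u v"
    and keep: "\<And>M p q. C M p \<Longrightarrow> R p q \<Longrightarrow> \<exists>M'. rel_mset R M M' \<and> C M' q"
    and sur: "\<And>M p. C M p \<Longrightarrow> open_nbhd G p \<subseteq> set_mset M"
    and b0: "placement G k b0"
    and start: "\<And>p. p \<in> pverts G \<Longrightarrow> force R C (mset b0) p"
  shows "bodyguards_can_win G k"
proof -
  have finR: "finite {q. R p q}" for p
    by (rule finite_subset[of _ "insert p (pverts G)"])
      (auto simp: R_step token_step_def open_nbhd_def fin)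
  define rk where "rk b p = (LEAST l. force_in R C l (mset b) p)" for b p
  \<comment> \<open>Existence of a bound \<open>l\<close> is demanded separately, because
    \<open>LEAST\<close> says nothing about positions without one.\<close>
  define \<sigma> where "\<sigma> h = (case last h of (b, p) \<Rightarrow>
      (ARG_MIN (\<lambda>b'. rk b' p) b'. list_all2 R b b' \<and> (\<exists>l. force_in R C l (mset b') p)))" for h
  have "winning_strategy G k b0 \<sigma>"
    unfolding winning_strategy_def
  proof (intro conjI allI impI b0)
    fix b p
    assume p: "president_legal G p" and "follows b0 \<sigma> b p"
    then have b_0: "b 0 = b0" and b_Suc: "\<And>t. b (Suc t) = \<sigma> (map (\<lambda>s. (b s, p s)) [0..<Suc t])"
      by (auto simp: follows_def)
    define ok where "ok t b' \<longleftrightarrow> list_all2 R (b t) b' \<and> (\<exists>l. force_in R C l (mset b') (p t))" for t b'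
    have b_Suc: "b (Suc t) = (ARG_MIN (\<lambda>b'. rk b' (p t)) b'. ok t b')" for t
      by (simp add: b_Suc \<sigma>_def ok_def)
    have chosen: "ok t (b (Suc t)) \<and> (\<forall>b'. ok t b' \<longrightarrow> rk (b (Suc t)) (p t) \<le> rk b' (p t))"
      if "ok t b'" for t b'
      unfolding b_Suc using arg_min_nat_lemma[of "ok t", OF that] .
    have pR: "R (p t) (p (Suc t))" for t
      using p president_stays_in_pverts[OF p] by (auto simp: R_step president_legal_def)
    have respond: "\<exists>b'. ok (Suc t) b' \<and> rk b' (p (Suc t)) \<le> rk (b (Suc t)) (p t) - 1"
      if "ok t (b (Suc t))" for t
    proof -
      let ?l = "rk (b (Suc t)) (p t)"
      have l: "force_in R C ?l (mset (b (Suc t))) (p t)"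
        using that unfolding ok_def rk_def by (metis LeastI)
      have "\<exists>M'. rel_mset R (mset (b (Suc t))) M' \<and> force_in R C (?l - 1) M' (p (Suc t))"
      proof (cases ?l)
        case 0
        then show ?thesis using l keep pR by simp
      next
        \<comment> \<open>Minimality of the rank rules out the first disjunct of
          \<open>force_in\<close>, so a move to the smaller bound remains.\<close>
        case (Suc j)
        then have "\<not> force_in R C j (mset (b (Suc t))) (p t)"
          unfolding rk_def using not_less_Least lessI by metis
        then show ?thesis using l pR Suc by auto
      qed
      then obtain b' where "list_all2 R (b (Suc t)) b'" "force_in R C (?l - 1) (mset b') (p (Suc t))"
        by (metis rel_mset_list_move)
      then show ?thesis
        unfolding ok_def rk_def by (metis Least_le)
    qed
    have ok: "ok t (b (Suc t))" for t
    proof (induction t)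
      case 0
      \<comment> \<open>In round 0 the guards may pass: \<open>start\<close> concerns the initial
        placement with the president to move.\<close>
      have "list_all2 R b0 b0"
        using b0 by (auto simp: placement_def R_step token_step_def intro!: list.rel_refl_strong)
      moreover have "\<exists>l. force_in R C l (mset b0) (p 0)"
        using p by (intro force_imp_force_in start finR) (simp add: president_legal_def)
      ultimately have "ok 0 b0" by (simp add: ok_def b_0)
      then show ?case using chosen by blast
    next
      case (Suc t)
      then show ?case using respond chosen by blast
    qed
    have rk_dec: "rk (b (Suc (Suc t))) (p (Suc t)) \<le> rk (b (Suc t)) (p t) - 1" for t
      using respond[OF ok] chosen by (meson order_trans)
    have rk_le: "rk (b (Suc t)) (p t) \<le> rk (b (Suc 0)) (p 0) - t" for t
    proof (induction t)
      case (Suc t)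
      then show ?case using rk_dec[of t] by simp
    qed simp
    have "surrounded G (b (Suc t)) (p t)" if "rk (b (Suc 0)) (p 0) \<le> t" for t
    proof -
      have "rk (b (Suc t)) (p t) = 0" using rk_le[of t] that by simp
      then have "force_in R C 0 (mset (b (Suc t))) (p t)"
        using ok[of t] unfolding ok_def rk_def by (metis LeastI)
      then show ?thesis using sur[of "mset (b (Suc t))" "p t"] by (simp add: surrounded_def)
    qed
    then show "bodyguards_win_play G b p" by (auto simp: bodyguards_win_play_def)
    show "bodyguards_legal G k b"
      unfolding bodyguards_legal_def
    proof (intro conjI allI)
      show "list_all2 (token_step G) (b t) (b (Suc t))" for t
        using ok[of t] by (auto simp: ok_def R_step elim: list_all2_mono)
    qed (simp add: b_0 b0)
  qed
  then show ?thesis unfolding bodyguards_can_win_def by blast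
qed

text \<open>\<open>I\<close> is an invariant of the positions with the guards to move, which the
  president restores every round. Playing these answers against a fixed strategy yields one play in
  which no guard turn ends with the president surrounded.\<close>

lemma not_bodyguards_can_winI:
  assumes start: "\<And>b. placement G k b \<Longrightarrow> \<exists>p \<in> pverts G. I b p"
    and evade: "\<And>b b' p. placement G k b \<Longrightarrow> I b p \<Longrightarrow> list_all2 (token_step G) b b' \<Longrightarrow>
      \<not> surrounded G b' p \<and> (\<exists>q. token_step G p q \<and> I b' q)"
  shows "\<not> bodyguards_can_win G k"
proof
  assume "bodyguards_can_win G k"
  then obtain b0 \<sigma> where win: "winning_strategy G k b0 \<sigma>"
    unfolding bodyguards_can_win_def by blast
  then have "placement G k b0" by (simp add: winning_strategy_def)
  then obtain p0 where p0: "p0 \<in> pverts G" "I b0 p0" using start by blast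
  \<comment> \<open>The implication keeps \<open>nxt\<close> a legal step even if no answer restores
    \<open>I\<close>. So the president's play is legal before anything is known about the guards,
    whose legality then follows from \<open>win\<close>.\<close>
  define nxt where "nxt b' p = (SOME q. token_step G p q \<and>
      ((\<exists>q. token_step G p q \<and> I b' q) \<longrightarrow> I b' q))" for b' p
  have nxt: "token_step G p (nxt b' p) \<and> ((\<exists>q. token_step G p q \<and> I b' q) \<longrightarrow> I b' (nxt b' p))"
    for b' p
  proof -
    have "\<exists>q. token_step G p q \<and> ((\<exists>q. token_step G p q \<and> I b' q) \<longrightarrow> I b' q)"
      by (metis token_step_def)
    then show ?thesis unfolding nxt_def by (rule someI_ex)
  qed
  \<comment> \<open>The recursion builds whole histories, since the strategy may depend on all of
    the past.\<close>
  define h where "h = rec_nat [(b0, p0)] (\<lambda>t h. h @ [(\<sigma> h, nxt (\<sigma> h) (snd (last h)))])"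
  have h0: "h 0 = [(b0, p0)]" and hS: "\<And>t. h (Suc t) = h t @ [(\<sigma> (h t), nxt (\<sigma> (h t)) (snd (last (h t))))]"
    by (simp_all add: h_def)
  define b p where "b t = fst (last (h t))" and "p t = snd (last (h t))" for t
  have h: "h t = map (\<lambda>s. (b s, p s)) [0..<Suc t]" for t
    by (induction t) (simp_all add: h0 hS b_def p_def)
  have b_Suc: "b (Suc t) = \<sigma> (h t)" and p_Suc: "p (Suc t) = nxt (b (Suc t)) (p t)" for t
    by (simp_all add: b_def p_def hS)
  have b_0: "b 0 = b0" and p_0: "p 0 = p0" by (simp_all add: b_def p_def h0)
  have "president_legal G p"
    using nxt p0 by (simp add: president_legal_def p_0 p_Suc)
  moreover have "follows b0 \<sigma> b p"
    unfolding follows_def b_Suc h b_0 by simp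
  ultimately have legal: "bodyguards_legal G k b" and bwin: "bodyguards_win_play G b p"
    using win by (auto simp: winning_strategy_def)
  have pl: "placement G k (b t)" for t
  proof (induction t)
    case 0
    then show ?case using legal by (simp add: bodyguards_legal_def)
  next
    case (Suc t)
    have la: "list_all2 (token_step G) (b t) (b (Suc t))"
      using legal by (simp add: bodyguards_legal_def)
    then have "v \<in> pverts G" if "v \<in> set (b (Suc t))" for v
      using Suc that by (auto simp: placement_def in_set_conv_nth list_all2_conv_all_nth
          token_step_def open_nbhd_def) (metis (lifting) nth_mem subsetD)+
    then show ?case using Suc la by (auto simp: placement_def dest: list_all2_lengthD)
  qed
  have "I (b t) (p t)" for t
  proof (induction t)
    case 0
    then show ?case using p0 by (simp add: b_0 p_0)
  next
    case (Suc t)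
    then show ?case
      using evade[OF pl Suc] legal nxt by (metis bodyguards_legal_def p_Suc)
  qed
  then have "\<not> surrounded G (b (Suc t)) (p t)" for t
    using evade[OF pl] legal by (meson bodyguards_legal_def)
  then show False using bwin by (auto simp: bodyguards_win_play_def)
qed

text \<open>A president who never leaves \<open>v\<close> wins, as \<open>k\<close> tokens cover at
  most \<open>k\<close> vertices.\<close>

lemma not_bodyguards_can_win_degree:
  assumes v: "v \<in> pverts G" and k: "k < card (open_nbhd G v)"
  shows "\<not> bodyguards_can_win G k"
proof (rule not_bodyguards_can_winI[where I = "\<lambda>b p. p = v"])
  fix b b' p
  assume "placement G k b" "p = v" "list_all2 (token_step G) b b'"
  then have "card (set b') \<le> k"
    by (metis placement_def card_length list_all2_lengthD)
  then show "\<not> surrounded G b' p \<and> (\<exists>q. token_step G p q \<and> q = v)"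
    using k \<open>p = v\<close> card_mono[of "set b'" "open_nbhd G v"]
    by (auto simp: surrounded_def token_step_def)
qed (use v in auto)

section \<open>Reaching targets on a grid\<close>

definition near :: "nat \<Rightarrow> nat \<Rightarrow> bool" where
  "near i j \<longleftrightarrow> i \<le> Suc j \<and> j \<le> Suc i"

definition on_grid :: "nat \<Rightarrow> nat \<Rightarrow> nat \<times> nat \<Rightarrow> bool" where
  "on_grid n m v \<longleftrightarrow> fst v < n \<and> snd v < m"

definition grid_step :: "nat \<Rightarrow> nat \<Rightarrow> nat \<times> nat \<Rightarrow> nat \<times> nat \<Rightarrow> bool" where
  "grid_step n m u v \<longleftrightarrow> on_grid n m u \<and> on_grid n m v \<and>
     (fst u = fst v \<and> near (snd u) (snd v) \<or> snd u = snd v \<and> near (fst u) (fst v))"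

lemma grid_step_Pair [simp]:
  "grid_step n m (i, j) (k, l) \<longleftrightarrow> i < n \<and> j < m \<and> k < n \<and> l < m \<and>
     (i = k \<and> near j l \<or> j = l \<and> near i k)"
  by (auto simp: grid_step_def on_grid_def)

lemma on_grid_Pair [simp]: "on_grid n m (i, j) \<longleftrightarrow> i < n \<and> j < m"
  by (simp add: on_grid_def)

lemma near_refl [simp]: "near i i"
  by (simp add: near_def)

lemma grid_step_refl: "on_grid n m u \<Longrightarrow> grid_step n m u u"
  by (simp add: grid_step_def)

lemma pverts_grid: "v \<in> pverts (path_graph n \<box> path_graph m) \<longleftrightarrow> on_grid n m v"
  by (cases v) (simp add: cartesian_product_def path_graph_def)

lemma open_nbhd_grid:
  "open_nbhd (path_graph n \<box> path_graph m) (i, j) =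
     {(k, l). i < n \<and> j < m \<and> k < n \<and> l < m \<and>
       (i = k \<and> (l = Suc j \<or> j = Suc l) \<or> j = l \<and> (k = Suc i \<or> i = Suc k))}"
  by (auto simp: open_nbhd_def cartesian_product_def path_graph_def)

lemma grid_step_iff:
  "grid_step n m u v \<longleftrightarrow>
     u \<in> pverts (path_graph n \<box> path_graph m) \<and> token_step (path_graph n \<box> path_graph m) u v"
  by (cases u; cases v) (auto simp: pverts_grid token_step_def open_nbhd_grid near_def)

lemma grid_can_winI:
  assumes keep: "\<And>M p q. C M p \<Longrightarrow> grid_step n m p q \<Longrightarrow>
      \<exists>M'. rel_mset (grid_step n m) M M' \<and> C M' q"
    and sur: "\<And>M p. C M p \<Longrightarrow> open_nbhd (path_graph n \<box> path_graph m) p \<subseteq> set_mset M"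
    and b0: "length b0 = k" "\<And>v. v \<in> set b0 \<Longrightarrow> on_grid n m v"
    and start: "\<And>p. on_grid n m p \<Longrightarrow> force (grid_step n m) C (mset b0) p"
  shows "bodyguards_can_win (path_graph n \<box> path_graph m) k"
proof (rule bodyguards_can_winI[where R = "grid_step n m" and C = C and ?b0.0 = b0])
  show "finite (pverts (path_graph n \<box> path_graph m))"
    by (simp add: cartesian_product_def path_graph_def)
qed (use assms in \<open>auto simp: grid_step_iff pverts_grid placement_def\<close>)

lemma rel_mset_pair: "R a a' \<Longrightarrow> R b b' \<Longrightarrow> rel_mset R {#a, b#} {#a', b'#}"
  by (intro rel_mset_Plus rel_mset_Zero)

lemma rel_mset_triple:
  "R a a' \<Longrightarrow> R b b' \<Longrightarrow> R c c' \<Longrightarrow> rel_mset R {#a, b, c#} {#a', b', c'#}"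
  by (intro rel_mset_Plus rel_mset_Zero)

lemma rel_mset_quadruple:
  "R a a' \<Longrightarrow> R b b' \<Longrightarrow> R c c' \<Longrightarrow> R d d' \<Longrightarrow>
     rel_mset R {#a, b, c, d#} {#a', b', c', d'#}"
  by (intro rel_mset_Plus rel_mset_Zero)

section \<open>Potentials for pursuing a moving target\<close>

definition nonexpansive :: "nat \<Rightarrow> (nat \<Rightarrow> nat) \<Rightarrow> bool" where
  "nonexpansive n f \<longleftrightarrow> (\<forall>i<n. f i < n) \<and> (\<forall>i<n. \<forall>j<n. near i j \<longrightarrow> near (f i) (f j))"

definition step_to :: "nat \<Rightarrow> nat \<Rightarrow> nat" where
  "step_to x t = (if x < t then Suc x else if t < x then x - 1 else x)"

text \<open>
  The potential of a token at \<open>x\<close> that chases a target at \<open>t\<close> on a path: the target either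
  comes closer or uses up the room it has left to run away. The weights 4 and 3 leave enough slack for
  the moves of the three-row chase below that gain no column.
\<close>

definition lag :: "nat \<Rightarrow> nat \<Rightarrow> nat \<Rightarrow> nat" where
  "lag n x t = (if x = t then 0 else if x < t then 4 * (t - x) + 3 * (n - t) else 4 * (x - t) + 3 * t)"

lemma lag_eq_0_iff [simp]: "lag n x t = 0 \<longleftrightarrow> x = t"
  by (simp add: lag_def)

lemma lag_bound: "x < n \<Longrightarrow> t < n \<Longrightarrow> lag n x t \<le> 7 * n"
  unfolding lag_def by (auto split: if_splits)

lemma near_step_to [simp]: "near x (step_to x t)"
  unfolding near_def step_to_def by auto

lemma step_to_less: "x < n \<Longrightarrow> t < n \<Longrightarrow> step_to x t < n"
  unfolding step_to_def by auto

text \<open>If the target stays, the distance shrinks by one; if it runs, the distance is kept but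
  its room shrinks; if it approaches, the distance shrinks by two, which outweighs the room
  regained. It cannot jump over the token.\<close>

lemma lag_step_to:
  assumes "x < n" "t < n" "t' < n" "near t t'" "x \<noteq> t"
  shows "lag n (step_to x t') t' < lag n x t"
  using assms unfolding lag_def step_to_def near_def by (auto split: if_splits)

text \<open>A lexicographic potential in one number: \<open>Suc (7 * m)\<close> exceeds every column
  lag (\<open>lag_bound\<close>), so entering the target's row always pays.\<close>

definition row_first :: "nat \<Rightarrow> nat \<Rightarrow> nat \<Rightarrow> nat \<Rightarrow> nat \<Rightarrow> nat \<Rightarrow> nat" where
  "row_first n m i j r c = (if i = r then lag m j c else Suc (7 * m) + lag n i r)"

text \<open>Outside the target's row the token steps towards that row. Inside it, the token copies
  every row change, during which the column of the target is fixed, and otherwise gains a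
  column.\<close>

lemma row_first_step:
  assumes x: "i < n" "j < m" and t: "r < n" "c < m" "r' < n" "c' < m"
    and mv: "r = r' \<and> near c c' \<or> c = c' \<and> near r r'"
  obtains i' j' where "grid_step n m (i, j) (i', j')"
    and "row_first n m i' j' r' c' \<le> row_first n m i j r c"
    and "r = r' \<Longrightarrow> row_first n m i' j' r' c' < row_first n m i j r c \<or> i' = r' \<and> j' = c'"
proof (cases "i = r")
  case False
  have "near r r'" using mv by auto
  then have "lag n (step_to i r') r' < lag n i r"
    using False x t by (intro lag_step_to) auto
  then have "row_first n m (step_to i r') j r' c' < row_first n m i j r c"
    using False lag_bound[of j m c'] x t by (auto simp: row_first_def)
  then show ?thesis
    using that[of "step_to i r'" j] x t by (auto simp: step_to_less)
next
  case True
  show ?thesis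
  proof (cases "r = r'")
    case same: True
    then have nc: "near c c'" using mv by auto
    show ?thesis
    proof (cases "j = c")
      case True
      then show ?thesis
        using that[of i c'] \<open>i = r\<close> same nc x t by (simp add: row_first_def lag_def)
    next
      case False
      then have "lag m (step_to j c') c' < lag m j c"
        using nc x t by (intro lag_step_to) auto
      then show ?thesis
        using that[of i "step_to j c'"] \<open>i = r\<close> same x t by (simp add: row_first_def step_to_less)
    qed
  next
    case False
    then show ?thesis
      using that[of r' j] \<open>i = r\<close> mv x t by (simp add: row_first_def)
  qed
qed

section \<open>Formations that follow the president, and reaching them\<close>

definition formation :: "nat \<Rightarrow> nat \<Rightarrow> (nat \<times> nat \<Rightarrow> (nat \<times> nat) multiset) \<Rightarrow> bool" where
  "formation n m A \<longleftrightarrow> (\<forall>p q. grid_step n m p q \<longrightarrow> rel_mset (grid_step n m) (A p) (A q))"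

lemma formationD: "formation n m A \<Longrightarrow> grid_step n m p q \<Longrightarrow> rel_mset (grid_step n m) (A p) (A q)"
  unfolding formation_def by blast

lemma formation_empty: "formation n m (\<lambda>p. {#})"
  by (simp add: formation_def)

lemma formation_idle:
  "formation n m A \<Longrightarrow> on_grid n m z \<Longrightarrow> formation n m (\<lambda>p. add_mset z (A p))"
  unfolding formation_def by (blast intro: rel_mset_Plus grid_step_refl)

definition target :: "(nat \<Rightarrow> nat) \<Rightarrow> (nat \<Rightarrow> nat) \<Rightarrow> nat \<times> nat \<Rightarrow> nat \<times> nat" where
  "target f g p = (f (fst p), g (snd p))"

lemma target_step:
  assumes "nonexpansive n f" "nonexpansive m g" "grid_step n m p q"
  shows "grid_step n m (target f g p) (target f g q)"
  using assms by (cases p; cases q) (auto simp: nonexpansive_def target_def)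

lemma formation_target:
  "formation n m A \<Longrightarrow> nonexpansive n f \<Longrightarrow> nonexpansive m g \<Longrightarrow>
     formation n m (\<lambda>p. add_mset (target f g p) (A p))"
  unfolding formation_def by (blast intro: rel_mset_Plus target_step)

text \<open>
  Of the two free guards, one first reaches the row of its target and the other one its column.
  Every president move leaves the row or the column of the target unchanged, so at least one of
  them makes progress, and neither ever loses any.
\<close>

lemma force_target:
  assumes A: "formation n m A" and f: "nonexpansive n f" and g: "nonexpansive m g"
    and "on_grid n m x" "on_grid n m y" "on_grid n m p"
  shows "force (grid_step n m)
     (\<lambda>M q. on_grid n m q \<and> (\<exists>z. on_grid n m z \<and> M = add_mset (target f g q) (add_mset z (A q))))
     (add_mset x (add_mset y (A p))) p" (is "force ?R ?Q _ _")
  using assms(4-6)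
\<comment> \<open>The second summand is \<open>row_first\<close> on the transposed grid, so
  \<open>y\<close> seeks the column of the target first.\<close>
proof (induction "row_first n m (fst x) (snd x) (f (fst p)) (g (snd p)) +
    row_first m n (snd y) (fst y) (g (snd p)) (f (fst p))" arbitrary: x y p rule: less_induct)
  case less
  obtain i j k l r c where xyp: "x = (i, j)" "y = (k, l)" "p = (r, c)"
    by (metis surj_pair)
  have "\<exists>M'. rel_mset ?R (add_mset x (add_mset y (A p))) M' \<and> force ?R ?Q M' q"
    if q: "?R p q" for q
  proof -
    obtain r' c' where q_eq: "q = (r', c')" by (metis surj_pair)
    have gr: "i < n" "j < m" "k < n" "l < m" "r < n" "c < m" "r' < n" "c' < m"
      using less.prems q by (simp_all add: xyp q_eq)
    then have T: "f r < n" "f r' < n" "g c < m" "g c' < m"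
      using f g by (simp_all add: nonexpansive_def)
    have one: "r = r' \<or> c = c'"
      using q by (auto simp: xyp q_eq)
    have mv: "f r = f r' \<and> near (g c) (g c') \<or> g c = g c' \<and> near (f r) (f r')"
      using q f g by (auto simp: xyp q_eq nonexpansive_def)
    then have mv': "g c = g c' \<and> near (f r) (f r') \<or> f r = f r' \<and> near (g c) (g c')"
      by blast
    obtain i' j' where x': "?R (i, j) (i', j')"
        "row_first n m i' j' (f r') (g c') \<le> row_first n m i j (f r) (g c)"
        "f r = f r' \<Longrightarrow> row_first n m i' j' (f r') (g c') < row_first n m i j (f r) (g c)
           \<or> i' = f r' \<and> j' = g c'"
      by (rule row_first_step[OF gr(1,2) T(1,3,2,4) mv]) blast
    obtain l' k' where y'': "grid_step m n (l, k) (l', k')"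
      and y': "row_first m n l' k' (g c') (f r') \<le> row_first m n l k (g c) (f r)"
        "g c = g c' \<Longrightarrow> row_first m n l' k' (g c') (f r') < row_first m n l k (g c) (f r)
           \<or> l' = g c' \<and> k' = f r'"
      by (rule row_first_step[OF gr(4,3) T(3,1,4,2) mv']) blast
    have ys: "?R (k, l) (k', l')" using y'' by auto
    let ?M = "add_mset (i', j') (add_mset (k', l') (A q))"
    have rel: "rel_mset ?R (add_mset x (add_mset y (A p))) ?M"
      using x'(1) ys formationD[OF A q] unfolding xyp by (intro rel_mset_Plus)
    have gr': "on_grid n m (i', j')" "on_grid n m (k', l')" "on_grid n m q"
      using x'(1) ys gr by (auto simp: q_eq)
    have "force ?R ?Q ?M q"
    proof (cases "(i', j') = target f g q \<or> (k', l') = target f g q")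
      case True
      then have "?Q ?M q" using gr' add_mset_commute by metis
      then show ?thesis by (rule force_now)
    next
      case False
      show ?thesis
      proof (rule less.hyps)
        show "row_first n m (fst (i', j')) (snd (i', j')) (f (fst q)) (g (snd q)) +
            row_first m n (snd (k', l')) (fst (k', l')) (g (snd q)) (f (fst q)) <
            row_first n m (fst x) (snd x) (f (fst p)) (g (snd p)) +
            row_first m n (snd y) (fst y) (g (snd p)) (f (fst p))"
          using False one x'(2,3) y' by (auto simp: xyp q_eq target_def)
      qed (use gr' in auto)
    qed
    then show ?thesis using rel by blast
  qed
  then show ?case by (intro force_step) blast
qed

lemma formation_idles:
  "formation n m A \<Longrightarrow> on_grid n m z \<Longrightarrow> formation n m (\<lambda>p. replicate_mset k z + A p)"
  by (induction k) (auto intro: formation_idle)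

lemma target_Pair [simp]: "target f g (r, c) = (f r, g c)"
  by (simp add: target_def)

text \<open>For each target, the spare guard is paired with one idle guard at \<open>z0\<close>, and
  \<open>force_target\<close> applies; the remaining idle guards count as part of the formation,
  which the reached target then joins.\<close>

lemma force_targets:
  assumes "formation n m A" and "on_grid n m z0" "on_grid n m x" "on_grid n m p"
    and "list_all (\<lambda>(f, g). nonexpansive n f \<and> nonexpansive m g) Ts"
  shows "force (grid_step n m)
     (\<lambda>M q. on_grid n m q \<and> (\<exists>z. on_grid n m z \<and>
        M = add_mset z (mset (map (\<lambda>(f, g). target f g q) Ts) + A q)))
     (add_mset x (replicate_mset (length Ts) z0 + A p)) p"
  using assms
proof (induction Ts arbitrary: A x p)
  case Nil
  then show ?case by (intro force_now conjI exI[of _ x]) auto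
next
  case (Cons T Ts)
  obtain f g where T: "T = (f, g)" by (metis surj_pair)
  then have fg: "nonexpansive n f" "nonexpansive m g" using Cons.prems(5) by auto
  have A': "formation n m (\<lambda>p. replicate_mset (length Ts) z0 + A p)"
    using Cons.prems by (intro formation_idles)
  have A'': "formation n m (\<lambda>p. add_mset (target f g p) (A p))"
    using Cons.prems fg by (intro formation_target)
  show ?case
  proof (rule force_trans)
    show "force (grid_step n m)
       (\<lambda>M q. on_grid n m q \<and> (\<exists>z. on_grid n m z \<and>
         M = add_mset (target f g q) (add_mset z (replicate_mset (length Ts) z0 + A q))))
       (add_mset x (replicate_mset (length (T # Ts)) z0 + A p)) p"
      using force_target[OF A' fg Cons.prems(3,2,4)] by simp
  next
    fix M q
    assume "on_grid n m q \<and> (\<exists>z. on_grid n m z \<and>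
         M = add_mset (target f g q) (add_mset z (replicate_mset (length Ts) z0 + A q)))"
    then obtain z where "on_grid n m q" "on_grid n m z"
      and M: "M = add_mset z (replicate_mset (length Ts) z0 + add_mset (target f g q) (A q))"
      by auto
    then show "force (grid_step n m)
        (\<lambda>M q. on_grid n m q \<and> (\<exists>z. on_grid n m z \<and>
          M = add_mset z (mset (map (\<lambda>(f, g). target f g q) (T # Ts)) + A q))) M q"
      using Cons.IH[OF A'' Cons.prems(2), of z q] Cons.prems(5) by (simp add: T)
  qed
qed

lemma force_targets_start:
  assumes "0 < n" "0 < m" "on_grid n m p"
    and "list_all (\<lambda>(f, g). nonexpansive n f \<and> nonexpansive m g) Ts"
  shows "force (grid_step n m)
     (\<lambda>M q. on_grid n m q \<and> (\<exists>z. on_grid n m z \<and>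
        M = add_mset z (mset (map (\<lambda>(f, g). target f g q) Ts))))
     (mset (replicate (Suc (length Ts)) (0, 0))) p"
  using force_targets[OF formation_empty, of n m "(0, 0)" "(0, 0)" p Ts] assms by simp

lemma nonexpansive_id: "nonexpansive n (\<lambda>i. i)"
  by (simp add: nonexpansive_def)

lemma nonexpansive_pred: "nonexpansive n (\<lambda>i. i - 1)"
  by (auto simp: nonexpansive_def near_def)

lemma nonexpansive_succ: "nonexpansive n (\<lambda>i. min (Suc i) (n - 1))"
  by (auto simp: nonexpansive_def near_def)

lemma nonexpansive_flip: "nonexpansive 2 (\<lambda>i. 1 - i)"
  by (auto simp: nonexpansive_def near_def)

lemmas nonexpansive_shifts = nonexpansive_id nonexpansive_pred nonexpansive_succ

section \<open>Five guards on an arbitrary grid\<close>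

text \<open>Truncated subtraction and \<open>min\<close> clamp the four neighbours to the grid.\<close>

definition cross :: "nat \<Rightarrow> nat \<Rightarrow> nat \<times> nat \<Rightarrow> (nat \<times> nat) multiset" where
  "cross n m p = {#target (\<lambda>i. i - 1) (\<lambda>j. j) p, target (\<lambda>i. min (Suc i) (n - 1)) (\<lambda>j. j) p,
     target (\<lambda>i. i) (\<lambda>j. j - 1) p, target (\<lambda>i. i) (\<lambda>j. min (Suc j) (m - 1)) p#}"

lemma formation_cross: "formation n m (cross n m)"
  unfolding cross_def
  by (intro formation_target formation_empty nonexpansive_shifts)

lemma cross_surrounds: "open_nbhd (path_graph n \<box> path_graph m) p \<subseteq> set_mset (cross n m p)"
  by (cases p) (auto simp: open_nbhd_grid cross_def)

lemma can_win_5: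
  assumes "0 < n" "0 < m"
  shows "bodyguards_can_win (path_graph n \<box> path_graph m) 5"
proof (rule grid_can_winI[where ?b0.0 = "replicate 5 (0, 0)" and
      C = "\<lambda>M p. on_grid n m p \<and> (\<exists>z. on_grid n m z \<and> M = add_mset z (cross n m p))"])
  fix M p q
  assume "on_grid n m p \<and> (\<exists>z. on_grid n m z \<and> M = add_mset z (cross n m p))" "grid_step n m p q"
  then show "\<exists>M'. rel_mset (grid_step n m) M M' \<and>
      (on_grid n m q \<and> (\<exists>z. on_grid n m z \<and> M' = add_mset z (cross n m q)))"
    using rel_mset_Plus[OF grid_step_refl formationD[OF formation_cross]]
    by (metis grid_step_def)
next
  fix p assume "on_grid n m p"
  then show "force (grid_step n m) (\<lambda>M p. on_grid n m p \<and> (\<exists>z. on_grid n m z \<and>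
      M = add_mset z (cross n m p))) (mset (replicate 5 (0, 0))) p"
    using force_targets_start[of n m p "[((\<lambda>i. i - 1), (\<lambda>j. j)), ((\<lambda>i. min (Suc i) (n - 1)), (\<lambda>j. j)),
      ((\<lambda>i. i), (\<lambda>j. j - 1)), ((\<lambda>i. i), (\<lambda>j. min (Suc j) (m - 1)))]"] assms nonexpansive_shifts
    by (simp add: cross_def numeral_eq_Suc del: One_nat_def)
next
  fix M p
  assume "on_grid n m p \<and> (\<exists>z. on_grid n m z \<and> M = add_mset z (cross n m p))"
  then show "open_nbhd (path_graph n \<box> path_graph m) p \<subseteq> set_mset M"
    using cross_surrounds[of n m p] by auto
qed (use assms in auto)

section \<open>Grids with two rows\<close>

definition tee :: "nat \<Rightarrow> nat \<times> nat \<Rightarrow> (nat \<times> nat) multiset" where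
  "tee m p = {#target (\<lambda>i. i) (\<lambda>j. j - 1) p, target (\<lambda>i. 1 - i) (\<lambda>j. j) p,
     target (\<lambda>i. i) (\<lambda>j. min (Suc j) (m - 1)) p#}"

lemma formation_tee: "formation 2 m (tee m)"
  unfolding tee_def
  by (intro formation_target formation_empty nonexpansive_shifts nonexpansive_flip)

lemma tee_surrounds: "open_nbhd (path_graph 2 \<box> path_graph m) p \<subseteq> set_mset (tee m p)"
  by (cases p) (auto simp: open_nbhd_grid tee_def)

lemma rel_mset_tripleI:
  "R a a' \<Longrightarrow> R b b' \<Longrightarrow> R c c' \<Longrightarrow> P {#a', b', c'#} \<Longrightarrow>
     \<exists>M'. rel_mset R {#a, b, c#} M' \<and> P M'"
  by (rule exI[of _ "{#a', b', c'#}"]) (simp add: rel_mset_triple)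

text \<open>Only the vertex \<open>(1 - r, c)\<close> is missing. A step to the left merely shifts
  the pattern, which cannot go on forever; after any other move the guards complete
  \<open>tee\<close>. If the president changes rows, the guard on its right becomes the one opposite
  it.\<close>

lemma force_tee_from_right:
  assumes "r < 2" "Suc c < m"
  shows "force (grid_step 2 m) (\<lambda>M q. on_grid 2 m q \<and> M = tee m q)
     {#(r, c - 1), (r, Suc c), (1 - r, Suc c)#} (r, c)" (is "force ?R ?Q _ _")
  using assms
proof (induction c arbitrary: r rule: less_induct)
  case (less c)
  have "\<exists>M'. rel_mset ?R {#(r, c - 1), (r, Suc c), (1 - r, Suc c)#} M' \<and> force ?R ?Q M' q"
    if "?R (r, c) q" for q
  proof -
    obtain r' c' where q: "q = (r', c')" by (metis surj_pair)
    have "r' = r \<and> c' = c \<or> r' = r \<and> c' = Suc c \<or> r' = r \<and> c = Suc c' \<or> r' = 1 - r \<and> c' = c"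
      using that less.prems unfolding q grid_step_Pair near_def by presburger
    then consider "r' = r" "c' = c" | "r' = r" "c' = Suc c" | "r' = r" "c = Suc c'"
      | "r' = 1 - r" "c' = c" by blast
    then show ?thesis
    proof cases
      case 1
      show ?thesis
        by (rule rel_mset_tripleI[where a' = "(r, c - 1)" and b' = "(r, Suc c)" and c' = "(1 - r, c)"])
          (use less.prems 1 in \<open>auto simp: q near_def tee_def add_mset_commute intro!: force_now\<close>)
    next
      case 2
      show ?thesis
        by (rule rel_mset_tripleI[where a' = "(r, c)" and b' = "(r, min (Suc (Suc c)) (m - 1))"
              and c' = "(1 - r, Suc c)"])
          (use less.prems 2 in \<open>auto simp: q near_def tee_def add_mset_commute intro!: force_now\<close>)
    next
      case 3
      show ?thesis
        by (rule rel_mset_tripleI[where a' = "(r, c' - 1)" and b' = "(r, Suc c')"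
              and c' = "(1 - r, Suc c')"])
          (use less.prems 3 in \<open>auto simp: q near_def simp del: One_nat_def intro!: less.IH\<close>)
    next
      case 4
      show ?thesis
        by (rule rel_mset_tripleI[where a' = "(r', c - 1)" and b' = "(1 - r', c)"
              and c' = "(r', Suc c)"])
          (use less.prems 4 in \<open>auto simp: q near_def tee_def intro!: force_now\<close>)
    qed
  qed
  then show ?case by (intro force_step) blast
qed

text \<open>The third guard is opposite its target. Steps to the right shift the pattern and use up
  \<open>m - c\<close>; a step to the left leads to \<open>tee\<close> or to
  \<open>force_tee_from_right\<close>; all else gives \<open>tee\<close> at once.\<close>

lemma force_tee_from_opposite_right:
  assumes "r < 2" "c < m"
  shows "force (grid_step 2 m) (\<lambda>M q. on_grid 2 m q \<and> M = tee m q)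
     {#(r, c - 1), (1 - r, c), (1 - r, min (Suc c) (m - 1))#} (r, c)" (is "force ?R ?Q _ _")
  using assms
proof (induction "m - c" arbitrary: r c rule: less_induct)
  case less
  have "\<exists>M'. rel_mset ?R {#(r, c - 1), (1 - r, c), (1 - r, min (Suc c) (m - 1))#} M' \<and> force ?R ?Q M' q"
    if "?R (r, c) q" for q
  proof -
    obtain r' c' where q: "q = (r', c')" by (metis surj_pair)
    have "r' = r \<and> c' = c \<or> r' = r \<and> c' = Suc c \<and> c' < m \<or> r' = r \<and> c = Suc c' \<and> Suc c = m \<or>
        r' = r \<and> c = Suc c' \<and> Suc c < m \<or> r' = 1 - r \<and> c' = c"
      using that less.prems unfolding q grid_step_Pair near_def by presburger
    then consider "r' = r" "c' = c" | "r' = r" "c' = Suc c" "c' < m" | "r' = r" "c = Suc c'" "Suc c = m"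
      | "r' = r" "c = Suc c'" "Suc c < m" | "r' = 1 - r" "c' = c" by blast
    then show ?thesis
    proof cases
      case 1
      show ?thesis
        by (rule rel_mset_tripleI[where a' = "(r, c - 1)" and b' = "(1 - r, c)"
              and c' = "(r, min (Suc c) (m - 1))"])
          (use less.prems 1 in \<open>auto simp: q near_def tee_def intro!: force_now\<close>)
    next
      case 2
      \<comment> \<open>In the last column the third guard is clamped to column \<open>c\<close>,
        hence already right of the president's new column.\<close>
      show ?thesis
        by (rule rel_mset_tripleI[where a' = "(r, c' - 1)" and b' = "(1 - r, c')"
              and c' = "(1 - r, min (Suc c') (m - 1))"])
          (use less.prems 2 less.hyps[of c' r] in \<open>auto simp: q near_def\<close>)
    next
      case 3
      show ?thesis
        by (rule rel_mset_tripleI[where a' = "(r, c' - 1)" and b' = "(1 - r, c')"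
              and c' = "(r, min (Suc c') (m - 1))"])
          (use less.prems 3 in \<open>auto simp: q near_def tee_def intro!: force_now\<close>)
    next
      case 4
      \<comment> \<open>The opposite guard enters the president's row behind it and the third guard
        takes its place, both one column to the right.\<close>
      show ?thesis
        by (rule rel_mset_tripleI[where a' = "(r, c' - 1)" and b' = "(r, Suc c')"
              and c' = "(1 - r, Suc c')"])
          (use less.prems 4 in \<open>auto simp: q near_def simp del: One_nat_def intro!: force_tee_from_right\<close>)
    next
      case 5
      show ?thesis
        by (rule rel_mset_tripleI[where a' = "(r', c - 1)" and b' = "(1 - r', c)"
              and c' = "(r', min (Suc c) (m - 1))"])
          (use less.prems 5 in \<open>auto simp: q near_def tee_def intro!: force_now\<close>)
    qed
  qed
  then show ?case by (intro force_step) blast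
qed

text \<open>The free guard chases only the column of its target. On arrival it is on the target or
  opposite it, there being just two rows.\<close>

lemma force_tee:
  assumes "on_grid 2 m x" "on_grid 2 m p"
  shows "force (grid_step 2 m) (\<lambda>M q. on_grid 2 m q \<and> M = tee m q)
     {#x, target (\<lambda>i. i) (\<lambda>j. j - 1) p, target (\<lambda>i. 1 - i) (\<lambda>j. j) p#} p" (is "force ?R ?Q _ _")
  using assms
proof (induction "lag m (snd x) (min (Suc (snd p)) (m - 1))" arbitrary: x p rule: less_induct)
  case less
  obtain i j r c where xp: "x = (i, j)" "p = (r, c)" by (metis surj_pair)
  show ?case
  proof (cases "j = min (Suc c) (m - 1)")
    case True
    have "i = r \<or> i = 1 - r" using less.prems by (auto simp: xp)
    then consider "i = r" | "i = 1 - r" by blast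
    then show ?thesis
    proof cases
      case 1
      then show ?thesis
        using less.prems True by (auto simp: xp tee_def add_mset_commute intro!: force_now)
    next
      case 2
      then show ?thesis
        using force_tee_from_opposite_right[of r c m] less.prems True
        by (simp add: xp add_mset_commute)
    qed
  next
    case False
    have "\<exists>M'. rel_mset ?R {#x, target (\<lambda>i. i) (\<lambda>j. j - 1) p, target (\<lambda>i. 1 - i) (\<lambda>j. j) p#} M' \<and>
        force ?R ?Q M' q" if q: "?R p q" for q
    proof -
      obtain r' c' where q_eq: "q = (r', c')" by (metis surj_pair)
      let ?j = "step_to j (min (Suc c') (m - 1))"
      have gr: "j < m" "i < 2" "c' < m" "c < m" "near c c'"
        using less.prems q by (auto simp: xp q_eq)
      have nt: "near (min (Suc c) (m - 1)) (min (Suc c') (m - 1))"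
        using gr nonexpansive_succ[of m] unfolding nonexpansive_def by blast
      have "lag m ?j (min (Suc c') (m - 1)) < lag m j (min (Suc c) (m - 1))"
        using False gr nt by (intro lag_step_to) auto
      moreover have "?j < m" using gr by (intro step_to_less) auto
      ultimately have "force ?R ?Q {#(i, ?j), target (\<lambda>i. i) (\<lambda>j. j - 1) q, target (\<lambda>i. 1 - i) (\<lambda>j. j) q#} q"
        using gr q by (intro less.hyps) (auto simp: xp q_eq)
      moreover have "?R x (i, ?j)" using gr \<open>?j < m\<close> by (simp add: xp)
      moreover have "?R (target (\<lambda>i. i) (\<lambda>j. j - 1) p) (target (\<lambda>i. i) (\<lambda>j. j - 1) q)"
        by (rule target_step[OF nonexpansive_id nonexpansive_pred q])
      moreover have "?R (target (\<lambda>i. 1 - i) (\<lambda>j. j) p) (target (\<lambda>i. 1 - i) (\<lambda>j. j) q)"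
        by (rule target_step[OF nonexpansive_flip nonexpansive_id q])
      ultimately show ?thesis
        by (intro rel_mset_tripleI)
    qed
    then show ?thesis by (intro force_step) blast
  qed
qed

lemma can_win_2_by_m:
  assumes "0 < m"
  shows "bodyguards_can_win (path_graph 2 \<box> path_graph m) 3"
proof (rule grid_can_winI[where ?b0.0 = "replicate 3 (0, 0)" and
      C = "\<lambda>M p. on_grid 2 m p \<and> M = tee m p"])
  fix p assume "on_grid 2 m p"
  then have "force (grid_step 2 m) (\<lambda>M q. on_grid 2 m q \<and> (\<exists>z. on_grid 2 m z \<and>
      M = {#z, target (\<lambda>i. i) (\<lambda>j. j - 1) q, target (\<lambda>i. 1 - i) (\<lambda>j. j) q#}))
      (mset (replicate 3 (0, 0))) p"
    using force_targets_start[of 2 m p "[((\<lambda>i. i), (\<lambda>j. j - 1)), ((\<lambda>i. 1 - i), (\<lambda>j. j))]"]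
      assms nonexpansive_shifts nonexpansive_flip
    by (simp add: numeral_eq_Suc del: One_nat_def)
  then show "force (grid_step 2 m) (\<lambda>M p. on_grid 2 m p \<and> M = tee m p)
      (mset (replicate 3 (0, 0))) p"
    by (rule force_trans) (use force_tee in blast)
qed (use assms tee_surrounds formationD[OF formation_tee] in \<open>auto simp: grid_step_def\<close>)

text \<open>On the 4-cycle the neighbours of a vertex form the other colour class. The guards start
  on one class and change class together when needed.\<close>

lemma can_win_2_by_2: "bodyguards_can_win (path_graph 2 \<box> path_graph 2) 2"
proof (rule grid_can_winI[where ?b0.0 = "[(0, 0), (1, 1)]" and
      C = "\<lambda>M p. on_grid 2 2 p \<and> M = {#(1 - fst p, snd p), (fst p, 1 - snd p)#}"])
  fix M p q
  assume "on_grid 2 2 p \<and> M = {#(1 - fst p, snd p), (fst p, 1 - snd p)#}" "grid_step 2 2 p q"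
  then show "\<exists>M'. rel_mset (grid_step 2 2) M M' \<and>
      (on_grid 2 2 q \<and> M' = {#(1 - fst q, snd q), (fst q, 1 - snd q)#})"
    by (cases p; cases q) (auto simp: near_def intro!: rel_mset_pair)
next
  fix M p
  assume "on_grid 2 2 p \<and> M = {#(1 - fst p, snd p), (fst p, 1 - snd p)#}"
  then show "open_nbhd (path_graph 2 \<box> path_graph 2) p \<subseteq> set_mset M"
    by (cases p) (auto simp: open_nbhd_grid)
next
  fix p assume p: "on_grid 2 2 p"
  let ?C = "\<lambda>M p. on_grid 2 2 p \<and> M = {#(1 - fst p, snd p), (fst p, 1 - snd p)#}"
  have "\<exists>M'. rel_mset (grid_step 2 2) (mset [(0, 0), (1, 1)]) M' \<and> ?C M' q"
    if "grid_step 2 2 p q" for q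
  proof (intro exI conjI)
    let ?M = "if fst q = snd q then {#(1, 0), (0, 1)#} else {#(0, 0), (1, 1)#}"
    show "rel_mset (grid_step 2 2) (mset [(0, 0), (1, 1)]) ?M"
      by (auto simp: near_def intro!: rel_mset_pair)
    show q: "on_grid 2 2 q" using that by (simp add: grid_step_def)
    show "?M = {#(1 - fst q, snd q), (fst q, 1 - snd q)#}"
      using q by (cases q) (auto simp: less_2_cases_iff)
  qed
  then show "force (grid_step 2 2) ?C (mset [(0, 0), (1, 1)]) p"
    by (intro force_step) (blast intro: force_now)
qed auto

section \<open>Grids with three rows\<close>

lemma rel_mset_quadrupleI:
  "R a a' \<Longrightarrow> R b b' \<Longrightarrow> R c c' \<Longrightarrow> R d d' \<Longrightarrow> P {#a', b', c', d'#} \<Longrightarrow>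
     \<exists>M'. rel_mset R {#a, b, c, d#} M' \<and> P M'"
  by (rule exI[of _ "{#a', b', c', d'#}"]) (simp add: rel_mset_quadruple)

text \<open>What is missing from \<open>cross\<close> is the clamped lower neighbour
  \<open>(2, c)\<close>; the fourth guard waits diagonally above. Only running right preserves this
  pattern, and the board ends. After any other move an exchange of roles completes
  \<open>cross\<close>.\<close>

lemma force_cross_from_left:
  assumes "0 < c" "c < m"
  shows "force (grid_step 3 m) (\<lambda>M q. on_grid 3 m q \<and> M = cross 3 m q)
     {#(1, c), (2, c - 1), (2, min (Suc c) (m - 1)), (1, c - 1)#} (2, c)" (is "force ?R ?Q _ _")
  using assms
proof (induction "m - c" arbitrary: c rule: less_induct)
  case less
  have "\<exists>M'. rel_mset ?R {#(1, c), (2, c - 1), (2, min (Suc c) (m - 1)), (1, c - 1)#} M' \<and>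
      force ?R ?Q M' q" if "?R (2, c) q" for q
  proof -
    obtain r' c' where q: "q = (r', c')" by (metis surj_pair)
    have "r' = 2 \<and> c' = c \<or> r' = 2 \<and> c' = Suc c \<and> c' < m \<or> r' = 2 \<and> c = Suc c' \<or> r' = 1 \<and> c' = c"
      using that less.prems unfolding q grid_step_Pair near_def by presburger
    then consider "r' = 2" "c' = c" | "r' = 2" "c' = Suc c" "c' < m" | "r' = 2" "c = Suc c'"
      | "r' = 1" "c' = c" by blast
    then show ?thesis
    proof cases
      case 1
      show ?thesis
        by (rule rel_mset_quadrupleI[where a' = "(1, c)" and b' = "(2, c)"
              and c' = "(2, min (Suc c) (m - 1))" and d' = "(2, c - 1)"])
          (use less.prems 1 in \<open>auto simp: q near_def cross_def add_mset_commute intro!: force_now\<close>)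
    next
      case 2
      show ?thesis
        by (rule rel_mset_quadrupleI[where a' = "(1, c')" and b' = "(2, c' - 1)"
              and c' = "(2, min (Suc c') (m - 1))" and d' = "(1, c' - 1)"])
          (use less.prems 2 less.hyps[of c'] in \<open>auto simp: q near_def\<close>)
    next
      case 3
      show ?thesis
        by (rule rel_mset_quadrupleI[where a' = "(1, c')" and b' = "(2, c' - 1)"
              and c' = "(2, c)" and d' = "(2, c')"])
          (use less.prems 3 in \<open>auto simp: q near_def cross_def add_mset_commute intro!: force_now\<close>)
    next
      case 4
      show ?thesis
        by (rule rel_mset_quadrupleI[where a' = "(0, c)" and b' = "(2, c)"
              and c' = "(1, min (Suc c) (m - 1))" and d' = "(1, c - 1)"])
          (use less.prems 4 in \<open>auto simp: q near_def cross_def numeral_2_eq_2 add_mset_commute intro!: force_now\<close>)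
    qed
  qed
  then show ?case by (intro force_step) blast
qed

text \<open>The mirror image of \<open>force_cross_from_left\<close>: now the president can delay
  only by running left, so \<open>c\<close> decreases.\<close>

lemma force_cross_from_right:
  assumes "Suc c < m"
  shows "force (grid_step 3 m) (\<lambda>M q. on_grid 3 m q \<and> M = cross 3 m q)
     {#(1, c), (2, Suc c), (2, c - 1), (1, Suc c)#} (2, c)" (is "force ?R ?Q _ _")
  using assms
proof (induction c rule: less_induct)
  case (less c)
  have "\<exists>M'. rel_mset ?R {#(1, c), (2, Suc c), (2, c - 1), (1, Suc c)#} M' \<and>
      force ?R ?Q M' q" if "?R (2, c) q" for q
  proof -
    obtain r' c' where q: "q = (r', c')" by (metis surj_pair)
    have "r' = 2 \<and> c' = c \<or> r' = 2 \<and> c = Suc c' \<or> r' = 2 \<and> c' = Suc c \<or> r' = 1 \<and> c' = c"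
      using that less.prems unfolding q grid_step_Pair near_def by presburger
    then consider "r' = 2" "c' = c" | "r' = 2" "c = Suc c'" | "r' = 2" "c' = Suc c"
      | "r' = 1" "c' = c" by blast
    then show ?thesis
    proof cases
      case 1
      show ?thesis
        by (rule rel_mset_quadrupleI[where a' = "(1, c)" and b' = "(2, c)"
              and c' = "(2, c - 1)" and d' = "(2, Suc c)"])
          (use less.prems 1 in \<open>auto simp: q near_def cross_def add_mset_commute intro!: force_now\<close>)
    next
      case 2
      show ?thesis
        by (rule rel_mset_quadrupleI[where a' = "(1, c')" and b' = "(2, Suc c')"
              and c' = "(2, c' - 1)" and d' = "(1, Suc c')"])
          (use less.prems 2 less.IH[of c'] in \<open>auto simp: q near_def\<close>)
    next
      case 3
      show ?thesis
        by (rule rel_mset_quadrupleI[where a' = "(1, c')" and b' = "(2, min (Suc c') (m - 1))"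
              and c' = "(2, c)" and d' = "(2, c')"])
          (use less.prems 3 in \<open>auto simp: q near_def cross_def add_mset_commute intro!: force_now\<close>)
    next
      case 4
      show ?thesis
        by (rule rel_mset_quadrupleI[where a' = "(0, c)" and b' = "(2, c)"
              and c' = "(1, c - 1)" and d' = "(1, Suc c)"])
          (use less.prems 4 in \<open>auto simp: q near_def cross_def numeral_2_eq_2 add_mset_commute intro!: force_now\<close>)
    qed
  qed
  then show ?case by (intro force_step) blast
qed

text \<open>
  The chase of the vertex above the president by a single guard at \<open>(i, x)\<close>. The guard keeps the
  row \<open>r - 1\<close>, except that when the president enters row 2, the guard may postpone leaving row 0 and
  gain a column instead.
\<close>

definition north_chase :: "nat \<Rightarrow> nat \<Rightarrow> nat \<Rightarrow> nat \<Rightarrow> bool" where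
  "north_chase i x r c \<longleftrightarrow> i = r - 1 \<or> r = 2 \<and> i = 0 \<and> x \<noteq> c"

text \<open>The extra term is a debt owed while the president is in row 2: 3 as long as the guard is
  still in row 0, and 1 once it has followed.\<close>

definition north_lag :: "nat \<Rightarrow> nat \<Rightarrow> nat \<Rightarrow> nat \<Rightarrow> nat \<Rightarrow> nat" where
  "north_lag m i x r c = lag m x c + (if r < 2 then 0 else if i = 0 then 3 else 1)"

lemma lag_step_to_far:
  "x < m \<Longrightarrow> c < m \<Longrightarrow> \<not> near x c \<Longrightarrow> lag m (step_to x c) c + 4 \<le> lag m x c"
  unfolding lag_def step_to_def near_def by (auto split: if_splits)

lemma step_to_far: "\<not> near x c \<Longrightarrow> step_to x c \<noteq> c"
  unfolding step_to_def near_def by auto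

text \<open>A target fleeing from a standing token adds 4 for distance and loses 3 of room.\<close>

lemma lag_target_moved:
  "c < m \<Longrightarrow> c' < m \<Longrightarrow> near c c' \<Longrightarrow> x \<noteq> c \<Longrightarrow> lag m x c' \<le> lag m x c + 1"
  unfolding lag_def near_def by (auto split: if_splits)

text \<open>The case excluded by \<open>ex\<close> is a president stepping down while the guard is
  one column off: following would add debt without any gain, and a column step would end at
  \<open>(0, c)\<close>, outside \<open>north_chase\<close>.\<close>

lemma north_chase_step:
  assumes x: "x < m" and p: "c < m" "r < 3" and mv: "grid_step 3 m (r, c) (r', c')"
    and chase: "north_chase i x r c" and free: "(i, x) \<noteq> (r - 1, c)"
    and ex: "\<not> (r = 1 \<and> r' = 2 \<and> near x c)"
  obtains i' x' where "grid_step 3 m (i, x) (i', x')"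
    and "(i', x') = (r' - 1, c') \<or> north_chase i' x' r' c' \<and> north_lag m i' x' r' c' < north_lag m i x r c"
proof -
  have xc: "x \<noteq> c" using chase free by (auto simp: north_chase_def)
  have nc: "near c c'" "c' < m" using mv by auto
  have dec: "lag m (step_to x c') c' < lag m x c"
    using x p nc xc by (intro lag_step_to)
  have sl: "step_to x c' < m" using x nc by (intro step_to_less)
  have r: "r = 0 \<or> r = 1 \<or> r = 2" "r' = 0 \<or> r' = 1 \<or> r' = 2" using mv by auto
  have "near r r'" "r = r' \<or> c = c'" using mv by auto
  then have "r = 2 \<and> i = 0 \<or> r = 2 \<and> i = 1 \<and> r' = 2 \<or> r = 2 \<and> i = 1 \<and> r' = 1 \<and> c = c' \<or>
      r < 2 \<and> i = 0 \<and> r' < 2 \<or> r = 1 \<and> i = 0 \<and> r' = 2 \<and> c = c'"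
    using r chase unfolding north_chase_def near_def by (elim disjE) simp_all
  then consider (late) "r = 2" "i = 0" | (stay) "r = 2" "i = 1" "r' = 2"
    | (leave) "r = 2" "i = 1" "r' = 1" "c = c'"
    | (upper) "r < 2" "i = 0" "r' < 2" | (down) "r = 1" "i = 0" "r' = 2" "c = c'"
    by blast
  then show ?thesis
  proof cases
    case late
    \<comment> \<open>If the president stays low, the guard makes up the row: the debt drops by 2
      while the lag grows by at most 1. If it returns to row 1, row 0 is right again and a column is
      gained.\<close>
    consider "r' = 2" | "r' = 1" using late r mv by (auto simp: near_def)
    then show ?thesis
    proof cases
      case 1
      then show ?thesis
        using that[of 1 x] late x p nc xc lag_target_moved[OF p(1) nc(2,1) xc]
        by (auto simp: north_chase_def north_lag_def near_def)
    next
      case 2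
      then show ?thesis
        using that[of 0 "step_to x c'"] late x p nc dec sl
        by (auto simp: north_chase_def north_lag_def)
    qed
  next
    case stay
    then show ?thesis
      using that[of 1 "step_to x c'"] x dec sl by (auto simp: north_chase_def north_lag_def)
  next
    case leave
    then show ?thesis
      using that[of 0 x] x by (auto simp: north_chase_def north_lag_def near_def)
  next
    case upper
    then show ?thesis
      using that[of 0 "step_to x c'"] x dec sl by (auto simp: north_chase_def north_lag_def)
  next
    case down
    \<comment> \<open>At distance at least 2 a column step gains 4, which pays for the debt of
      3.\<close>
    then have "\<not> near x c" using ex by auto
    then show ?thesis
      using that[of 0 "step_to x c"] down x p sl lag_step_to_far[of x m c] step_to_far[of x c]
      by (auto simp: north_chase_def north_lag_def)
  qed
qed

lemma nonexpansive_succ_3: "nonexpansive 3 (\<lambda>i. min (Suc i) 2)"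
  using nonexpansive_succ[of 3] by simp

definition escort3 :: "nat \<Rightarrow> nat \<times> nat \<Rightarrow> (nat \<times> nat) multiset" where
  "escort3 m p = {#target (\<lambda>i. min (Suc i) 2) (\<lambda>j. j) p,
     target (\<lambda>i. i) (\<lambda>j. j - 1) p, target (\<lambda>i. i) (\<lambda>j. min (Suc j) (m - 1)) p#}"

lemma formation_escort3: "formation 3 m (escort3 m)"
  unfolding escort3_def
  by (intro formation_target formation_empty nonexpansive_id nonexpansive_pred nonexpansive_succ
      nonexpansive_succ_3)

lemma cross_escort3: "cross 3 m p = add_mset (target (\<lambda>i. i - 1) (\<lambda>j. j) p) (escort3 m p)"
  by (simp add: cross_def escort3_def)

lemma force_cross_from_chase:
  assumes "i < 3" "x < m" "r < 3" "c < m" "north_chase i x r c"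
  shows "force (grid_step 3 m) (\<lambda>M q. on_grid 3 m q \<and> M = cross 3 m q)
     (add_mset (i, x) (escort3 m (r, c))) (r, c)" (is "force ?R ?Q _ _")
  using assms
proof (induction "north_lag m i x r c" arbitrary: i x r c rule: less_induct)
  case less
  note gr = less.prems(1-4)
  show ?case
  proof (cases "(i, x) = (r - 1, c)")
    case True
    then show ?thesis using gr by (intro force_now) (simp add: cross_escort3)
  next
    case False
    have "\<exists>M'. rel_mset ?R (add_mset (i, x) (escort3 m (r, c))) M' \<and> force ?R ?Q M' q"
      if mv: "?R (r, c) q" for q
    proof -
      obtain r' c' where q: "q = (r', c')" by (metis surj_pair)
      show ?thesis
      proof (cases "r = 1 \<and> r' = 2 \<and> near x c")
        case True
        then have rc: "i = 0" "r = 1" "q = (2, c)"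
          using less.prems(5) mv by (auto simp: north_chase_def q)
        have "x \<noteq> c" using False rc by auto
        then have "Suc x = c \<or> x = Suc c" using True unfolding near_def by linarith
        then consider "Suc x = c" | "x = Suc c" by blast
        then show ?thesis
        proof cases
          case 1
          \<comment> \<open>The lower guard trades places with the president and becomes the upper
            one, while the chaser drops to the diagonal vertex.\<close>
          have "rel_mset ?R {#(2, c), (1, c - 1), (1, min (Suc c) (m - 1)), (0, c - 1)#}
             {#(1, c), (2, c - 1), (2, min (Suc c) (m - 1)), (1, c - 1)#}"
            by (rule rel_mset_quadruple) (use gr in \<open>auto simp: near_def\<close>)
          moreover have "add_mset (i, x) (escort3 m (r, c)) =
              {#(2, c), (1, c - 1), (1, min (Suc c) (m - 1)), (0, c - 1)#}"
            using 1 rc by (auto simp: escort3_def numeral_2_eq_2)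
          ultimately show ?thesis
            using force_cross_from_left[of c m] 1 gr rc by auto
        next
          case 2
          have "rel_mset ?R {#(2, c), (1, Suc c), (1, c - 1), (0, Suc c)#}
             {#(1, c), (2, Suc c), (2, c - 1), (1, Suc c)#}"
            by (rule rel_mset_quadruple) (use gr 2 in \<open>auto simp: near_def\<close>)
          moreover have "add_mset (i, x) (escort3 m (r, c)) =
              {#(2, c), (1, Suc c), (1, c - 1), (0, Suc c)#}"
            using 2 rc gr by (auto simp: escort3_def numeral_2_eq_2)
          ultimately have "rel_mset ?R (add_mset (i, x) (escort3 m (r, c)))
              {#(1, c), (2, Suc c), (2, c - 1), (1, Suc c)#}" by (simp only:)
          moreover have "force ?R ?Q {#(1, c), (2, Suc c), (2, c - 1), (1, Suc c)#} q"
            using force_cross_from_right[of c m] 2 gr rc by simp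
          ultimately show ?thesis by blast
        qed
      next
        case ex: False
        obtain i' x' where step: "?R (i, x) (i', x')"
          and res: "(i', x') = (r' - 1, c') \<or>
            north_chase i' x' r' c' \<and> north_lag m i' x' r' c' < north_lag m i x r c"
          by (rule north_chase_step[OF gr(2,4,3) mv[unfolded q] less.prems(5) False ex]) blast
        have gr': "i' < 3" "x' < m" "r' < 3" "c' < m" using step mv by (auto simp: q)
        have "force ?R ?Q (add_mset (i', x') (escort3 m q)) q"
          using res
        proof
          assume "(i', x') = (r' - 1, c')"
          then show ?thesis using gr' by (intro force_now) (simp add: q cross_escort3)
        next
          assume "north_chase i' x' r' c' \<and> north_lag m i' x' r' c' < north_lag m i x r c"
          then show ?thesis using less.hyps[of i' x' r' c'] gr' by (simp add: q)
        qed
        then show ?thesis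
          using rel_mset_Plus[OF step formationD[OF formation_escort3 mv]] by blast
      qed
    qed
    then show ?thesis by (intro force_step) blast
  qed
qed

text \<open>The free guard first aligns only its row with \<open>r - 1\<close>, keeping its column;
  then \<open>north_chase\<close> takes over.\<close>

lemma force_cross_3:
  assumes "on_grid 3 m x" "on_grid 3 m p"
  shows "force (grid_step 3 m) (\<lambda>M q. on_grid 3 m q \<and> M = cross 3 m q)
     (add_mset x (escort3 m p)) p" (is "force ?R ?Q _ _")
  using assms
proof (induction "lag 3 (fst x) (fst p - 1)" arbitrary: x p rule: less_induct)
  case less
  obtain i j r c where xp: "x = (i, j)" "p = (r, c)" by (metis surj_pair)
  show ?case
  proof (cases "i = r - 1")
    case True
    then show ?thesis
      using force_cross_from_chase[of i j m r c] less.prems by (simp add: xp north_chase_def)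
  next
    case False
    have "\<exists>M'. rel_mset ?R (add_mset x (escort3 m p)) M' \<and> force ?R ?Q M' q" if q: "?R p q" for q
    proof -
      obtain r' c' where q_eq: "q = (r', c')" by (metis surj_pair)
      let ?i = "step_to i (r' - 1)"
      have gr: "i < 3" "j < m" "r < 3" "r' < 3" "near r r'"
        using less.prems q by (auto simp: xp q_eq)
      have "lag 3 ?i (r' - 1) < lag 3 i (r - 1)"
        using gr False by (intro lag_step_to) (auto simp: near_def)
      moreover have i: "?i < 3" using gr by (intro step_to_less) auto
      ultimately have "force ?R ?Q (add_mset (?i, j) (escort3 m q)) q"
        using gr q by (intro less.hyps) (auto simp: xp q_eq)
      moreover have "?R x (?i, j)" using gr i by (simp add: xp)
      then have "rel_mset ?R (add_mset x (escort3 m p)) (add_mset (?i, j) (escort3 m q))"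
        using formationD[OF formation_escort3 q] by (rule rel_mset_Plus)
      ultimately show ?thesis by blast
    qed
    then show ?thesis by (intro force_step) blast
  qed
qed

lemma can_win_3_by_m:
  assumes "0 < m"
  shows "bodyguards_can_win (path_graph 3 \<box> path_graph m) 4"
proof (rule grid_can_winI[where ?b0.0 = "replicate 4 (0, 0)" and
      C = "\<lambda>M p. on_grid 3 m p \<and> M = cross 3 m p"])
  fix p assume "on_grid 3 m p"
  then have "force (grid_step 3 m) (\<lambda>M q. on_grid 3 m q \<and> (\<exists>z. on_grid 3 m z \<and>
      M = add_mset z (escort3 m q))) (mset (replicate (Suc (Suc (Suc (Suc 0)))) (0, 0))) p"
    using force_targets_start[of 3 m p "[((\<lambda>i. min (Suc i) 2), (\<lambda>j. j)),
      ((\<lambda>i. i), (\<lambda>j. j - 1)), ((\<lambda>i. i), (\<lambda>j. min (Suc j) (m - 1)))]"]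
      assms nonexpansive_id nonexpansive_pred nonexpansive_succ[of m] nonexpansive_succ_3
    by (simp add: escort3_def del: One_nat_def)
  then have "force (grid_step 3 m) (\<lambda>M q. on_grid 3 m q \<and> (\<exists>z. on_grid 3 m z \<and>
      M = add_mset z (escort3 m q))) (mset (replicate 4 (0, 0))) p"
    by (simp add: eval_nat_numeral)
  then show "force (grid_step 3 m) (\<lambda>M p. on_grid 3 m p \<and> M = cross 3 m p)
      (mset (replicate 4 (0, 0))) p"
    by (rule force_trans) (use force_cross_3 in blast)
qed (use assms cross_surrounds formationD[OF formation_cross] in \<open>auto simp: grid_step_def\<close>)

section \<open>Lower bounds\<close>

text \<open>Moving flips the parity of the coordinate sum, so a token that ends in a prescribed
  colour class moves exactly if it starts in the other one.\<close>

lemma token_step_grid_parity: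
  assumes "token_step (path_graph n \<box> path_graph m) u v" "odd (fst v + snd v + s)"
  shows "\<bar>int (fst u) - int (fst v)\<bar> + \<bar>int (snd u) - int (snd v)\<bar> \<le> of_bool (even (fst u + snd u + s))"
    and "odd (fst u + snd u + s) \<Longrightarrow> v = u"
  using assms
  by (cases u; cases v; auto simp: token_step_def open_nbhd_grid split: if_splits)+

text \<open>Counts the tokens coloured like a vertex with coordinate sum \<open>s\<close>: those
  that must move in order to stand on its neighbours.\<close>

definition parity_count :: "(nat \<times> nat) list \<Rightarrow> nat \<Rightarrow> int" where
  "parity_count bs s = (\<Sum>b\<leftarrow>bs. of_bool (even (fst b + snd b + s)))"

lemma parity_count_Cons [simp]:
  "parity_count [] s = 0"
  "parity_count (b # bs) s = of_bool (even (fst b + snd b + s)) + parity_count bs s"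
  by (simp_all add: parity_count_def)

lemma parity_count_nonneg: "0 \<le> parity_count bs s"
  by (induction bs) auto

lemma parity_count_Suc: "parity_count bs (Suc s) = int (length bs) - parity_count bs s"
  by (induction bs) auto

lemma parity_count_cong: "even (s + s') \<Longrightarrow> parity_count bs s = parity_count bs s'"
  by (induction bs) auto

lemma moves_parity:
  assumes "list_all2 (token_step (path_graph n \<box> path_graph m)) bs bs'"
    and "\<forall>b \<in> set bs'. odd (fst b + snd b + s)"
  shows "\<bar>(\<Sum>b\<leftarrow>bs. int (fst b)) - (\<Sum>b\<leftarrow>bs'. int (fst b))\<bar> +
      \<bar>(\<Sum>b\<leftarrow>bs. int (snd b)) - (\<Sum>b\<leftarrow>bs'. int (snd b))\<bar> \<le> parity_count bs s"
    and "parity_count bs s = 0 \<Longrightarrow> bs' = bs"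
  using assms
proof (induction rule: list_all2_induct)
  case (Cons u us v vs)
  note tp = token_step_grid_parity[OF Cons.hyps(1), of s]
  { case 1
    then show ?case using Cons.IH(1) tp(1) by auto
  next
    case 2
    have "odd (fst u + snd u + s) \<and> parity_count us s = 0"
      using 2(1) parity_count_nonneg[of us s] by (cases "even (fst u + snd u + s)") (simp_all del: even_add)
    moreover have "odd (fst v + snd v + s)" "\<forall>b \<in> set vs. odd (fst b + snd b + s)"
      using 2(2) by simp_all
    ultimately show ?case using Cons.IH(2) tp(2) by blast
  }
qed simp_all

definition reach :: "nat \<Rightarrow> nat \<Rightarrow> (nat \<times> nat) list \<Rightarrow> nat \<times> nat \<Rightarrow> bool" where
  "reach n m bs v \<longleftrightarrow> (\<exists>bs'. list_all2 (token_step (path_graph n \<box> path_graph m)) bs bs' \<and>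
     surrounded (path_graph n \<box> path_graph m) bs' v)"

lemma mset_eq_of_distinct_subset:
  assumes "distinct xs" "set xs \<subseteq> set ys" "length ys = length xs"
  shows "mset ys = mset xs"
proof -
  have "mset xs = mset_set (set xs)" using assms by (simp add: mset_set_set)
  also have "\<dots> \<subseteq># mset_set (set ys)" using assms by (intro subset_imp_msubset_mset_set) auto
  also have "\<dots> \<subseteq># mset ys" using mset_set_set_mset_msubset[of "mset ys"] by simp
  finally have "mset xs \<subseteq># mset ys" .
  moreover have "size (mset xs) = size (mset ys)" using assms by simp
  ultimately show ?thesis by (metis mset_subset_size subset_mset.le_imp_less_or_eq less_irrefl)
qed

text \<open>Four guards must fill the four neighbours bijectively. These have coordinate sums
  \<open>4 * r\<close> and \<open>4 * c\<close>, and each moving guard changes one sum by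
  one.\<close>

lemma reach_interior:
  assumes "reach n m bs (r, c)" "length bs = 4" "0 < r" "Suc r < n" "0 < c" "Suc c < m"
  shows "\<bar>(\<Sum>b\<leftarrow>bs. int (fst b)) - 4 * int r\<bar> + \<bar>(\<Sum>b\<leftarrow>bs. int (snd b)) - 4 * int c\<bar>
      \<le> parity_count bs (r + c)"
    and "parity_count bs (r + c) = 0 \<Longrightarrow> surrounded (path_graph n \<box> path_graph m) bs (r, c)"
proof -
  let ?G = "path_graph n \<box> path_graph m"
  let ?N = "[(r - 1, c), (Suc r, c), (r, c - 1), (r, Suc c)]"
  obtain bs' where mv: "list_all2 (token_step ?G) bs bs'" and sur: "surrounded ?G bs' (r, c)"
    using assms(1) by (auto simp: reach_def)
  have "set ?N \<subseteq> open_nbhd ?G (r, c)"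
    using assms by (auto simp: open_nbhd_grid)
  then have "mset bs' = mset ?N"
    using sur mv assms
    by (intro mset_eq_of_distinct_subset) (auto simp: surrounded_def dest: list_all2_lengthD)
  then have set: "set bs' = set ?N" and sums: "(\<Sum>b\<leftarrow>bs'. f b) = (\<Sum>b\<leftarrow>?N. f b)" for f :: "_ \<Rightarrow> int"
    by (metis set_mset_mset, metis mset_map sum_mset_sum_list)
  have odd: "\<forall>b \<in> set bs'. odd (fst b + snd b + (r + c))"
    unfolding set using assms by auto
  have "(\<Sum>b\<leftarrow>bs'. int (fst b)) = 4 * int r" "(\<Sum>b\<leftarrow>bs'. int (snd b)) = 4 * int c"
    using assms by (simp_all add: sums)
  then show "\<bar>(\<Sum>b\<leftarrow>bs. int (fst b)) - 4 * int r\<bar> + \<bar>(\<Sum>b\<leftarrow>bs. int (snd b)) - 4 * int c\<bar>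
      \<le> parity_count bs (r + c)"
    using moves_parity(1)[OF mv odd] by simp
  show "surrounded ?G bs (r, c)" if "parity_count bs (r + c) = 0"
    using moves_parity(2)[OF mv odd that] sur by simp
qed

text \<open>
  A guard whose parity differs from that of the president's vertex must stay, the others must move.
  If \<open>(r, c)\<close> and its two neighbours in the central square can all be surrounded in one move, adding
  up the displacements that this requires shows that all four guards already have the right parity.
\<close>

lemma reach_square:
  assumes len: "length bs = 4" and nm: "4 \<le> n" "4 \<le> m" and rc: "r \<in> {1, 2}" "c \<in> {1, 2}"
    and re: "reach n m bs (r, c)" "reach n m bs (3 - r, c)" "reach n m bs (r, 3 - c)"
  shows "parity_count bs (r + c) = 0"
proof -
  have b: "0 < r" "Suc r < n" "0 < c" "Suc c < m" "0 < 3 - r" "Suc (3 - r) < n" "0 < 3 - c" "Suc (3 - c) < m"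
    using nm rc by auto
  have "even (3 - r + c + Suc (r + c))" "even (r + (3 - c) + Suc (r + c))"
    using rc by auto
  note this[THEN parity_count_cong, of bs]
  then have p: "parity_count bs (3 - r + c) = 4 - parity_count bs (r + c)"
      "parity_count bs (r + (3 - c)) = 4 - parity_count bs (r + c)"
    using parity_count_Suc[of bs "r + c"] len by simp_all
  let ?X = "\<Sum>b\<leftarrow>bs. int (fst b)" and ?Y = "\<Sum>b\<leftarrow>bs. int (snd b)"
  have "\<bar>4 * int (3 - r) - 4 * int r\<bar> = 4" "\<bar>4 * int (3 - c) - 4 * int c\<bar> = 4"
    using rc by auto
  then have "4 \<le> \<bar>?X - 4 * int r\<bar> + \<bar>?X - 4 * int (3 - r)\<bar>"
    "4 \<le> \<bar>?Y - 4 * int c\<bar> + \<bar>?Y - 4 * int (3 - c)\<bar>"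
    by linarith+
  \<comment> \<open>Adding the bounds for the last two vertices gives
    \<open>8 \<le> 8 - 2 * parity_count bs (r + c)\<close>.\<close>
  then show ?thesis
    using reach_interior(1)[OF re(1) len b(1-4)] reach_interior(1)[OF re(2) len b(5,6,3,4)]
      reach_interior(1)[OF re(3) len b(1,2,7,8)] parity_count_nonneg[of bs "r + c"]
    unfolding p by linarith
qed

text \<open>The invariant says that the guards cannot surround the president in one move. If it
  failed for staying and for both steps within the square, no guard would have to move to surround
  \<open>(r, c)\<close>, so the president would be surrounded already.\<close>

lemma not_can_win_4:
  assumes nm: "4 \<le> n" "4 \<le> m"
  shows "\<not> bodyguards_can_win (path_graph n \<box> path_graph m) 4"
proof (rule not_bodyguards_can_winI[where
      I = "\<lambda>bs p. p \<in> {1, 2} \<times> {1, 2} \<and> \<not> reach n m bs p"])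
  fix bs
  assume "placement (path_graph n \<box> path_graph m) 4 bs"
  then have len: "length bs = 4" by (simp add: placement_def)
  have "\<exists>p \<in> {1, 2} \<times> {1, 2}. \<not> reach n m bs p"
  proof (rule ccontr)
    assume "\<not> ?thesis"
    then have re: "reach n m bs (1, 1)" "reach n m bs (1, 2)" "reach n m bs (2, 1)" "reach n m bs (2, 2)"
      by simp_all
    \<comment> \<open>Otherwise both colour classes would be empty of guards, although their counts
      add up to 4.\<close>
    have "parity_count bs (1 + 1) = 0"
      by (rule reach_square[OF len nm]) (use re in simp_all)
    moreover have "parity_count bs (1 + 2) = 0"
      by (rule reach_square[OF len nm]) (use re in simp_all)
    ultimately show False using parity_count_Suc[of bs "1 + 1"] len by simp
  qed
  moreover have "{1, 2} \<times> {1, 2} \<subseteq> pverts (path_graph n \<box> path_graph m)"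
    using nm by (auto simp: pverts_grid)
  ultimately show "\<exists>p \<in> pverts (path_graph n \<box> path_graph m). p \<in> {1, 2} \<times> {1, 2} \<and> \<not> reach n m bs p"
    by blast
next
  fix bs bs' p
  assume pl: "placement (path_graph n \<box> path_graph m) 4 bs"
    and I: "p \<in> {1, 2} \<times> {1, 2} \<and> \<not> reach n m bs p"
    and mv: "list_all2 (token_step (path_graph n \<box> path_graph m)) bs bs'"
  have ns: "\<not> surrounded (path_graph n \<box> path_graph m) bs' p"
    using I mv by (auto simp: reach_def)
  have len: "length bs' = 4" using pl mv by (auto simp: placement_def dest: list_all2_lengthD)
  obtain r c where p: "p = (r, c)" and rc: "r \<in> {1, 2}" "c \<in> {1, 2}" using I by auto
  have "\<exists>q \<in> {(r, c), (3 - r, c), (r, 3 - c)}. \<not> reach n m bs' q"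
  proof (rule ccontr)
    assume "\<not> ?thesis"
    then have re: "reach n m bs' (r, c)" "reach n m bs' (3 - r, c)" "reach n m bs' (r, 3 - c)" by auto
    have "parity_count bs' (r + c) = 0" using reach_square[OF len nm rc re] .
    then have "surrounded (path_graph n \<box> path_graph m) bs' (r, c)"
      using reach_interior(2)[OF re(1) len] rc nm by auto
    then show False using ns p by simp
  qed
  then obtain q where q: "q \<in> {(r, c), (3 - r, c), (r, 3 - c)}" "\<not> reach n m bs' q" by blast
  then have "token_step (path_graph n \<box> path_graph m) p q" "q \<in> {1, 2} \<times> {1, 2}"
    using rc nm by (auto simp: token_step_def open_nbhd_grid p)
  then show "\<not> surrounded (path_graph n \<box> path_graph m) bs' p \<and>
      (\<exists>q. token_step (path_graph n \<box> path_graph m) p q \<and> q \<in> {1, 2} \<times> {1, 2} \<and> \<not> reach n m bs' q)"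
    using ns q by blast
qed

section \<open>Degree bounds and the exact values\<close>

lemma not_can_win_interior:
  assumes "3 \<le> n" "3 \<le> m" "k < 4"
  shows "\<not> bodyguards_can_win (path_graph n \<box> path_graph m) k"
proof (rule not_bodyguards_can_win_degree)
  show "(1, 1) \<in> pverts (path_graph n \<box> path_graph m)" using assms by (simp add: pverts_grid)
  have "open_nbhd (path_graph n \<box> path_graph m) (1, 1) = {(0, 1), (2, 1), (1, 0), (1, 2)}"
    using assms by (auto simp: open_nbhd_grid)
  then show "k < card (open_nbhd (path_graph n \<box> path_graph m) (1, 1))"
    using assms by simp
qed

lemma not_can_win_2_by_m:
  assumes "3 \<le> m" "k < 3"
  shows "\<not> bodyguards_can_win (path_graph 2 \<box> path_graph m) k"
proof (rule not_bodyguards_can_win_degree)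
  show "(0, 1) \<in> pverts (path_graph 2 \<box> path_graph m)" using assms by (simp add: pverts_grid)
  have "open_nbhd (path_graph 2 \<box> path_graph m) (0, 1) = {(0, 0), (0, 2), (1, 1)}"
    using assms by (auto simp: open_nbhd_grid)
  then show "k < card (open_nbhd (path_graph 2 \<box> path_graph m) (0, 1))"
    using assms by simp
qed

lemma not_can_win_2_by_2:
  assumes "k < 2"
  shows "\<not> bodyguards_can_win (path_graph 2 \<box> path_graph 2) k"
proof (rule not_bodyguards_can_win_degree)
  show "(0, 0) \<in> pverts (path_graph 2 \<box> path_graph 2)" by (simp add: pverts_grid)
  have "open_nbhd (path_graph 2 \<box> path_graph 2) (0, 0) = {(0, 1), (1, 0)}"
    by (auto simp: open_nbhd_grid)
  then show "k < card (open_nbhd (path_graph 2 \<box> path_graph 2) (0, 0))"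
    using assms by simp
qed

lemma bodyguard_number_eqI:
  assumes "bodyguards_can_win G k" "\<And>j. j < k \<Longrightarrow> \<not> bodyguards_can_win G j"
  shows "bodyguard_number G = k"
  unfolding bodyguard_number_def
  using assms by (intro Least_equality) (auto simp: not_less[symmetric])

theorem theorem4p6:
  fixes n m :: nat
  assumes "0 < n" and "0 < m" and "n \<le> m"
  shows "(n = 2 \<and> m = 2 \<longrightarrow> bodyguard_number (path_graph n \<box> path_graph m) = 2) \<and>
         (n = 2 \<and> m \<ge> 3 \<longrightarrow> bodyguard_number (path_graph n \<box> path_graph m) = 3) \<and>
         (n = 3 \<and> m \<ge> 3 \<longrightarrow> bodyguard_number (path_graph n \<box> path_graph m) = 4) \<and>
         (n \<ge> 4 \<and> m \<ge> 4 \<longrightarrow> bodyguard_number (path_graph n \<box> path_graph m) = 5)"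
proof (intro conjI impI; elim conjE)
  assume "n = 2" "m = 2"
  then show "bodyguard_number (path_graph n \<box> path_graph m) = 2"
    using can_win_2_by_2 not_can_win_2_by_2 by (auto intro: bodyguard_number_eqI)
next
  assume "n = 2" "3 \<le> m"
  then show "bodyguard_number (path_graph n \<box> path_graph m) = 3"
    using can_win_2_by_m[OF assms(2)] not_can_win_2_by_m by (auto intro: bodyguard_number_eqI)
next
  assume "n = 3" "3 \<le> m"
  then show "bodyguard_number (path_graph n \<box> path_graph m) = 4"
    using can_win_3_by_m[OF assms(2)] not_can_win_interior[of n m] by (auto intro: bodyguard_number_eqI)
next
  assume nm: "4 \<le> n" "4 \<le> m"
  show "bodyguard_number (path_graph n \<box> path_graph m) = 5"
  proof (rule bodyguard_number_eqI)
    show "bodyguards_can_win (path_graph n \<box> path_graph m) 5"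
      by (rule can_win_5[OF assms(1,2)])
    show "\<not> bodyguards_can_win (path_graph n \<box> path_graph m) j" if "j < 5" for j
      using that nm not_can_win_4[OF nm] not_can_win_interior[of n m j] by (cases "j = 4") auto
  qed
qed

end
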